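(* For any permutation $p\in\mathfrak S_3$, every integer $k\ge 2$ and every integer $n\ge 0$, $$\bigl|[k]^n(p)\bigr|=\frac{2^{n-2(k-2)}}{k-1}\sum_{j=0}^{k-2}(2k-2j-3)\binom{2j}{j}\binom{2(k-2-j)}{k-2-j}\binom{n+2j}{2j}.$$
   Context: $\mathfrak S_3$ is the set of permutations of $\{1,2,3\}$. A word $w=w_1\cdots w_n$ with positive integer letters contains $p=p_1p_2p_3\in\mathfrak S_3$ if there are indices $1\le i_1<i_2<i_3\le n$ such that $w_{i_1}w_{i_2}w_{i_3}$ is order isomorphic to $p$ (i.e. $w_{i_s}<w_{i_t}\iff p_s<p_t$; in particular the three letters are distinct); otherwise $w$ avoids $p$. $[k]^n(p)$ denotes the set of words of length $n$ with letters in $[k]=\{1,\dots,k\}$ that avoid $p$ (for $n=0$ it consists of the empty word only). *)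

theory Defs
  imports Complex_Main "HOL-Combinatorics.Permutations"
begin

definition order_isomorphic :: "nat list \<Rightarrow> nat list \<Rightarrow> bool" where
  "order_isomorphic u v \<longleftrightarrow> length u = length v \<and>
     (\<forall>s<length u. \<forall>t<length u. u ! s < u ! t \<longleftrightarrow> v ! s < v ! t)"

text \<open>A pattern is a permutation \<open>p\<close> of \<open>{1, 2, 3}\<close>, given as a function (\<open>p permutes {1, 2, 3}\<close>);
  its one-line notation is \<open>[p 1, p 2, p 3]\<close>. List positions are counted from 0.\<close>

definition contains_pattern :: "nat list \<Rightarrow> (nat \<Rightarrow> nat) \<Rightarrow> bool" where
  "contains_pattern w p \<longleftrightarrow>
     (\<exists>i\<^sub>1 i\<^sub>2 i\<^sub>3. i\<^sub>1 < i\<^sub>2 \<and> i\<^sub>2 < i\<^sub>3 \<and> i\<^sub>3 < length w \<and>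
        order_isomorphic [w ! i\<^sub>1, w ! i\<^sub>2, w ! i\<^sub>3] [p 1, p 2, p 3])"

definition avoiding_words :: "nat \<Rightarrow> nat \<Rightarrow> (nat \<Rightarrow> nat) \<Rightarrow> nat list set" where
  "avoiding_words k n p =
     {w. length w = n \<and> set w \<subseteq> {1..k} \<and> \<not> contains_pattern w p}"

end

theory Submission
  imports Defs "HOL-Computational_Algebra.Formal_Power_Series"
begin

text \<open>
  Reversing a word and replacing each letter \<open>x\<close> by \<open>k + 1 - x\<close> permute the six patterns with two
  orbits, represented by 213 and 123, so it suffices to count for these two. A word avoids 213 (or
  123) iff before each letter the smaller letters occur in weakly increasing (or weakly decreasing)
  order. A copy of the largest letter can therefore be inserted exactly where the smaller letters
  before it are already sorted, and words are best counted together with the length of a sorted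
  prefix. Let \<open>c k n s\<close> be the number of avoiding words of length \<open>n\<close> over \<open>{1..k}\<close> whose first \<open>s\<close>
  letters exist and are sorted. Removing a copy of the largest letter \<open>k + 1\<close> shows in both cases that

  \<open>c (k+1) n (s+1) - c (k+1) n (s+2) = c k n (s+1) - c k n (s+2) + c (k+1) (n-1) s - c (k+1) (n-2) s\<close>

  with the terms for negative lengths read as 0 (\<open>prefix_count_ascending_recurrence\<close>,
  \<open>prefix_count_descending_recurrence\<close>). Together with the boundary values this determines \<open>c\<close>
  (\<open>recurrence_unique\<close>).

  The last two terms of the recurrence multiply a generating function in \<open>x\<close> by \<open>z = x - x^2\<close>. Hence
  the recurrence can be solved in powers of \<open>z\<close>: the generating function of \<open>c k n s\<close> is the sum of
  \<open>b M s * ((M + k - 1) choose M) * z^M\<close> over \<open>M\<close>, where \<open>b M s\<close> are the ballot numbers, and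
  \<open>b M 0\<close> is the Catalan number (\<open>prefix_count_eq_word_series\<close>).

  For the closed form put \<open>K = k - 2\<close> and \<open>R = (1 - 4 z)^(-1/2)\<close>. At \<open>K = 0\<close> the series in \<open>z\<close> is \<open>R\<close>
  itself, and \<open>K\<close> is raised by the operator \<open>(z d/dz + K + 2) / (K + 2)\<close>, which maps combinations of
  odd powers of \<open>R\<close> to such combinations (\<open>ballot_series_closed_form\<close>). Since
  \<open>1 - 4 z = (1 - 2 x)^2\<close>, substituting \<open>z = x - x^2\<close> turns \<open>R\<close> into \<open>1 / (1 - 2 x)\<close>, and
  the coefficients \<open>2^n * ((n + 2 j) choose (2 j))\<close> of its odd powers give the formula.
\<close>

section \<open>Avoidance as sortedness of the smaller letters\<close>

text \<open>The letters smaller than a given letter, and standing before it, are to be sorted. For \<open>(\<le>)\<close> this is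
  avoidance of 213, for \<open>(\<ge>)\<close> avoidance of 123; having the order as a parameter lets the two patterns
  share everything except the derivation of the recurrence.\<close>
definition sorted_below :: "(nat \<Rightarrow> nat \<Rightarrow> bool) \<Rightarrow> nat list \<Rightarrow> bool" where
  "sorted_below R w \<longleftrightarrow> (\<forall>l < length w. sorted_wrt R (filter (\<lambda>y. y < w ! l) (take l w)))"

text \<open>The condition \<open>s \<le> n\<close> matters, since \<open>take s\<close> is the identity beyond the end of a word: with it,
  membership says that the longest sorted prefix has length at least \<open>s\<close>.\<close>
definition sorted_prefix_words :: "(nat \<Rightarrow> nat \<Rightarrow> bool) \<Rightarrow> nat \<Rightarrow> nat \<Rightarrow> nat \<Rightarrow> nat list set" where
  "sorted_prefix_words R k n s =
     {w. length w = n \<and> set w \<subseteq> {1..k} \<and> sorted_below R w \<and> s \<le> n \<and> sorted_wrt R (take s w)}"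

lemma sorted_below_Nil [simp]: "sorted_below R []"
  by (simp add: sorted_below_def)

lemma sorted_below_snoc:
  "sorted_below R (w @ [x]) \<longleftrightarrow> sorted_below R w \<and> sorted_wrt R (filter (\<lambda>y. y < x) w)"
  unfolding sorted_below_def by (auto simp: less_Suc_eq nth_append)

text \<open>The letters after a largest letter do not see it, because only smaller letters count. Inserting it
  therefore imposes one condition, on the letters in front of it.\<close>
lemma sorted_below_insert_max:
  assumes "\<forall>x\<in>set v. x \<le> m"
  shows "sorted_below R (u @ m # v) \<longleftrightarrow> sorted_below R (u @ v) \<and> sorted_wrt R (filter (\<lambda>y. y < m) u)"
  using assms
proof (induction v rule: rev_induct)
  case Nil
  then show ?case by (simp add: sorted_below_snoc)
next
  case (snoc x v)
  have "sorted_below R (u @ m # v @ [x]) \<longleftrightarrow>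
      sorted_below R (u @ m # v) \<and> sorted_wrt R (filter (\<lambda>y. y < x) (u @ m # v))"
    using sorted_below_snoc[of R "u @ m # v" x] by simp
  moreover have "filter (\<lambda>y. y < x) (u @ m # v) = filter (\<lambda>y. y < x) (u @ v)"
    using snoc.prems by simp
  moreover have "sorted_below R (u @ v @ [x]) \<longleftrightarrow>
      sorted_below R (u @ v) \<and> sorted_wrt R (filter (\<lambda>y. y < x) (u @ v))"
    using sorted_below_snoc[of R "u @ v" x] by simp
  ultimately show ?case using snoc by auto
qed

lemma finite_sorted_prefix_words [simp]: "finite (sorted_prefix_words R k n s)"
  by (rule finite_subset[OF _ finite_lists_length_eq[of "{1..k}" n]])
     (auto simp: sorted_prefix_words_def)

lemma sorted_prefix_words_antimono:
  assumes "s \<le> t" shows "sorted_prefix_words R k n t \<subseteq> sorted_prefix_words R k n s"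
proof
  fix w assume w: "w \<in> sorted_prefix_words R k n t"
  have "sorted_wrt R (take s w)"
    using w assms sorted_wrt_take[of R "take t w" s] by (simp add: sorted_prefix_words_def min_absorb1)
  then show "w \<in> sorted_prefix_words R k n s"
    using w assms by (simp add: sorted_prefix_words_def)
qed

lemma sorted_prefix_words_alphabet:
  "w \<in> sorted_prefix_words R k n s \<longleftrightarrow> w \<in> sorted_prefix_words R (Suc k) n s \<and> Suc k \<notin> set w"
  by (auto simp: sorted_prefix_words_def le_Suc_eq)

text \<open>Positions compared with themselves carry no information, so six comparisons remain.\<close>
lemma order_isomorphic_3:
  "order_isomorphic [a, b, c] [x, y, z] \<longleftrightarrow>
     (a < b \<longleftrightarrow> x < y) \<and> (b < a \<longleftrightarrow> y < x) \<and> (a < c \<longleftrightarrow> x < z) \<and> (c < a \<longleftrightarrow> z < x) \<and>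
     (b < c \<longleftrightarrow> y < z) \<and> (c < b \<longleftrightarrow> z < y)"
  by (simp add: order_isomorphic_def numeral_3_eq_3 All_less_Suc) blast

lemma sorted_below_iff:
  "sorted_below R w \<longleftrightarrow> (\<forall>i j l. i < j \<longrightarrow> j < l \<longrightarrow> l < length w \<longrightarrow>
     w ! i < w ! l \<longrightarrow> w ! j < w ! l \<longrightarrow> R (w ! i) (w ! j))"
proof -
  have filter: "sorted_wrt R (filter P xs) \<longleftrightarrow> sorted_wrt (\<lambda>x y. P x \<longrightarrow> P y \<longrightarrow> R x y) xs" for P xs
    by (induction xs) auto
  have "sorted_wrt (\<lambda>x y. x < w ! l \<longrightarrow> y < w ! l \<longrightarrow> R x y) (take l w) \<longleftrightarrow>
     (\<forall>i j. i < j \<longrightarrow> j < l \<longrightarrow> w ! i < w ! l \<longrightarrow> w ! j < w ! l \<longrightarrow> R (w ! i) (w ! j))"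
    if "l < length w" for l
    using that by (auto simp: sorted_wrt_iff_nth_less)
  then show ?thesis unfolding sorted_below_def filter by blast
qed

lemma avoids_123_iff:
  assumes "p 1 = 1" "p 2 = 2" "p 3 = 3"
  shows "\<not> contains_pattern w p \<longleftrightarrow> sorted_below (\<ge>) w"
proof -
  have "order_isomorphic [a, b, c] [p 1, p 2, p 3] \<longleftrightarrow> a < c \<and> b < c \<and> \<not> b \<le> a" for a b c
    unfolding assms order_isomorphic_3 by auto
  then show ?thesis unfolding contains_pattern_def sorted_below_iff by blast
qed

lemma avoids_213_iff:
  assumes "p 1 = 2" "p 2 = 1" "p 3 = 3"
  shows "\<not> contains_pattern w p \<longleftrightarrow> sorted_below (\<le>) w"
proof -
  have "order_isomorphic [a, b, c] [p 1, p 2, p 3] \<longleftrightarrow> a < c \<and> b < c \<and> \<not> a \<le> b" for a b c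
    unfolding assms order_isomorphic_3 by auto
  then show ?thesis unfolding contains_pattern_def sorted_below_iff by blast
qed

section \<open>The symmetries of words and patterns\<close>

lemma contains_pattern_rev:
  assumes "contains_pattern w p" "q 1 = p 3" "q 2 = p 2" "q 3 = p 1"
  shows "contains_pattern (rev w) q"
proof -
  obtain i j l where ijl: "i < j" "j < l" "l < length w"
    and iso: "order_isomorphic [w ! i, w ! j, w ! l] [p 1, p 2, p 3]"
    using assms(1) unfolding contains_pattern_def by blast
  let ?r = "\<lambda>i. length w - Suc i"
  have "?r l < ?r j" "?r j < ?r i" "?r i < length (rev w)" using ijl by auto
  moreover have "order_isomorphic [rev w ! ?r l, rev w ! ?r j, rev w ! ?r i] [q 1, q 2, q 3]"
    using iso ijl unfolding order_isomorphic_3 assms(2-4) by (auto simp: rev_nth)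
  ultimately show ?thesis unfolding contains_pattern_def by blast
qed

lemma card_avoiding_words_rev:
  assumes "q 1 = p 3" "q 2 = p 2" "q 3 = p 1"
  shows "card (avoiding_words k n q) = card (avoiding_words k n p)"
proof -
  have "rev w \<in> avoiding_words k n q \<longleftrightarrow> w \<in> avoiding_words k n p" for w
    using contains_pattern_rev[of w p q] contains_pattern_rev[of "rev w" q p] assms
    by (auto simp: avoiding_words_def)
  \<comment> \<open>The second instance, simplified by involutivity of reversal, covers the inverse map.\<close>
  from this this[of "rev w" for w]
  have "bij_betw rev (avoiding_words k n p) (avoiding_words k n q)"
    by (intro bij_betwI[where g = rev]) simp_all
  then show ?thesis by (simp add: bij_betw_same_card)
qed

text \<open>Complementing reverses all comparisons between letters, as long as the subtraction is not
  truncated; hence the bounds on letters and on pattern values.\<close>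
lemma contains_pattern_complement:
  assumes "contains_pattern w p" "set w \<subseteq> {1..k}"
    and "p 1 \<le> 3" "p 2 \<le> 3" "p 3 \<le> 3" "q 1 = 4 - p 1" "q 2 = 4 - p 2" "q 3 = 4 - p 3"
  shows "contains_pattern (map (\<lambda>x. Suc k - x) w) q"
proof -
  obtain i j l where ijl: "i < j" "j < l" "l < length w"
    and iso: "order_isomorphic [w ! i, w ! j, w ! l] [p 1, p 2, p 3]"
    using assms(1) unfolding contains_pattern_def by blast
  let ?c = "map (\<lambda>x. Suc k - x) w"
  have flip: "Suc k - x < Suc k - y \<longleftrightarrow> y < x" if "x \<in> set w" "y \<in> set w" for x y
    using assms(2) that by auto
  have flip_pattern: "4 - x < 4 - y \<longleftrightarrow> y < x" if "x \<le> 3" "y \<le> 3" for x y :: nat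
    using that by auto
  have mem: "w ! i \<in> set w" "w ! j \<in> set w" "w ! l \<in> set w" using ijl by auto
  have nth: "?c ! i = Suc k - w ! i" "?c ! j = Suc k - w ! j" "?c ! l = Suc k - w ! l"
    using ijl by auto
  have "order_isomorphic [?c ! i, ?c ! j, ?c ! l] [q 1, q 2, q 3]"
    using iso unfolding order_isomorphic_3 assms(6-8) nth
    by (simp only: flip mem flip_pattern assms(3-5))
  moreover have "l < length ?c" using ijl by simp
  ultimately show ?thesis unfolding contains_pattern_def using ijl(1,2) by blast
qed

lemma card_avoiding_words_complement:
  assumes "p 1 \<in> {1, 2, 3}" "p 2 \<in> {1, 2, 3}" "p 3 \<in> {1, 2, 3}"
    and "q 1 = 4 - p 1" "q 2 = 4 - p 2" "q 3 = 4 - p 3"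
  shows "card (avoiding_words k n q) = card (avoiding_words k n p)"
proof -
  let ?c = "map (\<lambda>x. Suc k - x)"
  have range: "set (?c w) \<subseteq> {1..k}" if "set w \<subseteq> {1..k}" for w
    using that by (auto simp: Suc_le_eq subset_iff)
  have inv: "?c (?c w) = w" if "set w \<subseteq> {1..k}" for w
    unfolding map_map by (rule map_idI) (use that in auto)
  have "p 1 = 4 - q 1" "p 2 = 4 - q 2" "p 3 = 4 - q 3" "q 1 \<le> 3" "q 2 \<le> 3" "q 3 \<le> 3"
    and "p 1 \<le> 3" "p 2 \<le> 3" "p 3 \<le> 3"
    using assms by auto
  note bounds = this
  have "contains_pattern (?c w) q \<longleftrightarrow> contains_pattern w p" if w: "set w \<subseteq> {1..k}" for w
  proof
    assume "contains_pattern (?c w) q"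
    from contains_pattern_complement[OF this range[OF w] bounds(4-6,1-3)]
    show "contains_pattern w p" unfolding inv[OF w] .
  next
    assume "contains_pattern w p"
    from contains_pattern_complement[OF this w bounds(7-9) assms(4-6)]
    show "contains_pattern (?c w) q" .
  qed
  then have c: "?c w \<in> avoiding_words k n q \<longleftrightarrow> w \<in> avoiding_words k n p" if "set w \<subseteq> {1..k}" for w
    using range[OF that] that by (simp add: avoiding_words_def)
  have "bij_betw ?c (avoiding_words k n p) (avoiding_words k n q)"
  proof (rule bij_betwI[where g = ?c])
    show "?c \<in> avoiding_words k n p \<rightarrow> avoiding_words k n q"
    proof
      fix w assume w: "w \<in> avoiding_words k n p"
      then have "set w \<subseteq> {1..k}" by (simp add: avoiding_words_def)
      then show "?c w \<in> avoiding_words k n q" using c w by simp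
    qed
    show "?c \<in> avoiding_words k n q \<rightarrow> avoiding_words k n p"
    proof
      fix w assume w: "w \<in> avoiding_words k n q"
      then have "set w \<subseteq> {1..k}" by (simp add: avoiding_words_def)
      then show "?c w \<in> avoiding_words k n p" using c[OF range] inv w by simp
    qed
  qed (use inv in \<open>auto simp: avoiding_words_def\<close>)
  then show ?thesis by (simp add: bij_betw_same_card)
qed

lemma permutation_3_cases:
  assumes "p permutes {1, 2, 3 :: nat}"
  obtains "p 1 = 1" "p 2 = 2" "p 3 = 3" | "p 1 = 3" "p 2 = 2" "p 3 = 1"
    | "p 1 = 2" "p 2 = 1" "p 3 = 3" | "p 1 = 3" "p 2 = 1" "p 3 = 2"
    | "p 1 = 2" "p 2 = 3" "p 3 = 1" | "p 1 = 1" "p 2 = 3" "p 3 = 2"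
proof -
  have "p 1 \<in> {1, 2, 3}" "p 2 \<in> {1, 2, 3}" "p 3 \<in> {1, 2, 3}"
    by (simp_all only: permutes_in_image[OF assms]) simp_all
  then have "p 1 = 1 \<or> p 1 = 2 \<or> p 1 = 3" "p 2 = 1 \<or> p 2 = 2 \<or> p 2 = 3" "p 3 = 1 \<or> p 3 = 2 \<or> p 3 = 3"
    by (simp_all only: insert_iff empty_iff simp_thms)
  moreover have "p 1 \<noteq> p 2" "p 1 \<noteq> p 3" "p 2 \<noteq> p 3"
    using inj_eq[OF permutes_inj[OF assms]] by simp_all
  ultimately show thesis using that by metis
qed

section \<open>Insertion of the largest letter\<close>

definition insert_at :: "nat \<Rightarrow> 'a \<Rightarrow> 'a list \<Rightarrow> 'a list" where
  "insert_at s x w = take s w @ x # drop s w"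

definition delete_at :: "nat \<Rightarrow> 'a list \<Rightarrow> 'a list" where
  "delete_at s w = take s w @ drop (Suc s) w"

lemma delete_insert_at: "s \<le> length w \<Longrightarrow> delete_at s (insert_at s x w) = w"
  by (simp add: delete_at_def insert_at_def)

lemma insert_delete_at: "s < length w \<Longrightarrow> insert_at s (w ! s) (delete_at s w) = w"
  by (simp add: delete_at_def insert_at_def id_take_nth_drop[symmetric])

lemma insert_at_simps [simp]:
  "s \<le> length w \<Longrightarrow> length (insert_at s x w) = Suc (length w)"
  "set (insert_at s x w) = insert x (set w)"
  "s \<le> length w \<Longrightarrow> insert_at s x w ! s = x"
  "t < s \<Longrightarrow> s \<le> length w \<Longrightarrow> insert_at s x w ! t = w ! t"
  "t \<le> s \<Longrightarrow> s \<le> length w \<Longrightarrow> take t (insert_at s x w) = take t w"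
  "s \<le> length w \<Longrightarrow> take (Suc s) (insert_at s x w) = take s w @ [x]"
      apply (simp add: insert_at_def)
     apply (simp add: insert_at_def, metis append_take_drop_id set_append)
    apply (simp_all add: insert_at_def nth_append min_absorb1)
  done

lemma delete_at_cases:
  assumes "s < length w"
  obtains v where "w = insert_at s (w ! s) v" "length w = Suc (length v)" "s \<le> length v"
proof
  show "w = insert_at s (w ! s) (delete_at s w)" using insert_delete_at[OF assms] by simp
  show "length w = Suc (length (delete_at s w))" "s \<le> length (delete_at s w)"
    using assms by (auto simp: delete_at_def)
qed

lemma inj_on_insert_at:
  assumes "\<And>w. w \<in> A \<Longrightarrow> s \<le> length w" shows "inj_on (insert_at s x) A"
  by (rule inj_on_inverseI[where g = "delete_at s"]) (simp add: assms delete_insert_at)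

lemma sorted_below_insert_at:
  assumes "set w \<subseteq> {1..m}"
  shows "sorted_below R (insert_at s m w) \<longleftrightarrow>
    sorted_below R w \<and> sorted_wrt R (filter (\<lambda>y. y < m) (take s w))"
proof -
  have "\<forall>x\<in>set (drop s w). x \<le> m" using assms by (auto dest: in_set_dropD)
  from sorted_below_insert_max[OF this, of R "take s w"] show ?thesis
    by (simp add: insert_at_def)
qed

lemma sorted_before_max:
  assumes "sorted_below R w" "set w \<subseteq> {1..m}" "i < length w" "w ! i = m"
  shows "sorted_wrt R (filter (\<lambda>y. y < m) (take i w))"
  using assms by (auto simp: sorted_below_def)

lemma first_occurrence:
  assumes "x \<in> set w"
  obtains p where "p < length w" "w ! p = x" "x \<notin> set (take p w)"
proof -
  obtain u v where "w = u @ x # v" "x \<notin> set u" using split_list_first[OF assms] by blast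
  then show ?thesis by (intro that[of "length u"]) auto
qed

lemma sorted_before_first_max:
  assumes "w \<in> sorted_prefix_words R m n s" "m \<in> set w"
  obtains p where "p < n" "w ! p = m" "sorted_wrt R (take p w)"
proof -
  obtain p where p: "p < length w" "w ! p = m" "m \<notin> set (take p w)"
    using first_occurrence[OF assms(2)] .
  have "x < m" if "x \<in> set (take p w)" for x
  proof -
    have "x \<le> m" using assms(1) in_set_takeD[OF that] by (auto simp: sorted_prefix_words_def)
    then show ?thesis using that p(3) by (cases "x = m") auto
  qed
  then have "filter (\<lambda>y. y < m) (take p w) = take p w" by simp
  then show ?thesis
    using that[of p] p assms(1) sorted_before_max[of R w m p] by (auto simp: sorted_prefix_words_def)
qed

definition prefix_count :: "(nat \<Rightarrow> nat \<Rightarrow> bool) \<Rightarrow> nat \<Rightarrow> nat \<Rightarrow> nat \<Rightarrow> real" where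
  "prefix_count R k n s = real (card (sorted_prefix_words R k n s))"

lemma card_Diff_real: "B \<subseteq> A \<Longrightarrow> finite A \<Longrightarrow> real (card (A - B)) = real (card A) - real (card B)"
  by (simp add: card_Diff_subset finite_subset card_mono of_nat_diff)

text \<open>The guards give the terms for negative lengths the value 0, which truncated subtraction would not.\<close>
definition top_letter_recurrence :: "(nat \<Rightarrow> nat \<Rightarrow> nat \<Rightarrow> real) \<Rightarrow> bool" where
  "top_letter_recurrence c \<longleftrightarrow> (\<forall>k n s.
     c (Suc k) n (Suc s) - c (Suc k) n (Suc (Suc s)) =
     c k n (Suc s) - c k n (Suc (Suc s))
     + (if n \<ge> 1 then c (Suc k) (n - 1) s else 0) - (if n \<ge> 2 then c (Suc k) (n - 2) s else 0))"

section \<open>The recurrence for the pattern 213\<close>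

text \<open>Putting a largest letter at the end of a weakly increasing prefix keeps that prefix increasing and
  makes it one longer. The map is inverted by deleting the letter.\<close>
lemma insert_at_mem_ascending:
  assumes "s \<le> length w" "set w \<subseteq> {1..m}" "m \<ge> 1"
  shows "insert_at s m w \<in> sorted_prefix_words (\<le>) m (Suc n) (Suc s)
    \<longleftrightarrow> w \<in> sorted_prefix_words (\<le>) m n s"
proof -
  have "set (take s w) \<subseteq> {1..m}" using assms(2) by (auto dest: in_set_takeD)
  then have "sorted_wrt (\<le>) (take s w @ [m]) \<longleftrightarrow> sorted_wrt (\<le>) (take s w)"
    by (auto simp: sorted_wrt_append)
  then show ?thesis using assms
    by (auto simp: sorted_prefix_words_def sorted_below_insert_at intro: sorted_wrt_filter)
qed

lemma ascending_top_at:
  assumes m: "m \<ge> 1"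
  shows "{w \<in> sorted_prefix_words (\<le>) m (Suc n) (Suc s). w ! s = m}
     = insert_at s m ` sorted_prefix_words (\<le>) m n s" (is "?L = ?R")
proof (rule set_eqI)
  fix w
  show "w \<in> ?L \<longleftrightarrow> w \<in> ?R"
  proof
    assume w: "w \<in> ?L"
    then have "s < length w" by (auto simp: sorted_prefix_words_def)
    from delete_at_cases[OF this] obtain v where v: "w = insert_at s (w ! s) v" "s \<le> length v" .
    have "w = insert_at s m v" using v(1) w by simp
    moreover have "set v \<subseteq> {1..m}" using w by (subst (asm) v(1)) (auto simp: sorted_prefix_words_def)
    ultimately show "w \<in> ?R" using w v insert_at_mem_ascending[OF v(2) _ m, of n] by auto
  next
    assume "w \<in> ?R"
    then obtain v where v: "w = insert_at s m v" "v \<in> sorted_prefix_words (\<le>) m n s" by blast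
    then have "s \<le> length v" "set v \<subseteq> {1..m}" by (auto simp: sorted_prefix_words_def)
    then show "w \<in> ?L" using v insert_at_mem_ascending[of s v m n] m by auto
  qed
qed

lemma card_ascending_top_at:
  assumes "m \<ge> 1"
  shows "card {w \<in> sorted_prefix_words (\<le>) m n (Suc s). w ! s = m}
     = (if n \<ge> 1 then card (sorted_prefix_words (\<le>) m (n - 1) s) else 0)"
proof (cases n)
  case 0
  then show ?thesis by (simp add: sorted_prefix_words_def)
next
  case (Suc n')
  have "inj_on (insert_at s m) (sorted_prefix_words (\<le>) m n' s)"
    by (rule inj_on_insert_at) (auto simp: sorted_prefix_words_def)
  then show ?thesis using Suc ascending_top_at[OF assms, of n' s] by (simp add: card_image)
qed

text \<open>Two adjacent largest letters at the end of the prefix are inserted one after the other: the second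
  insertion leaves the letter in front of it in place.\<close>
lemma card_ascending_top_twice:
  assumes "m \<ge> 1"
  shows "card {w \<in> sorted_prefix_words (\<le>) m n (Suc (Suc s)). w ! s = m \<and> w ! Suc s = m}
     = (if n \<ge> 2 then card (sorted_prefix_words (\<le>) m (n - 2) s) else 0)"
proof (cases n)
  case 0
  then show ?thesis by (simp add: sorted_prefix_words_def)
next
  case (Suc n')
  have sub: "s < length w" if "w \<in> sorted_prefix_words (\<le>) m n' (Suc s)" for w
    using that by (auto simp: sorted_prefix_words_def)
  have "{w \<in> sorted_prefix_words (\<le>) m n (Suc (Suc s)). w ! s = m \<and> w ! Suc s = m}
      = {w \<in> insert_at (Suc s) m ` sorted_prefix_words (\<le>) m n' (Suc s). w ! s = m}"
    using ascending_top_at[OF assms, of n' "Suc s"] Suc by auto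
  also have "\<dots> = insert_at (Suc s) m ` {w \<in> sorted_prefix_words (\<le>) m n' (Suc s). w ! s = m}"
  proof -
    have "insert_at (Suc s) m v ! s = v ! s" if "v \<in> sorted_prefix_words (\<le>) m n' (Suc s)" for v
      using sub[OF that] by simp
    then have "{v \<in> sorted_prefix_words (\<le>) m n' (Suc s). insert_at (Suc s) m v ! s = m}
        = {v \<in> sorted_prefix_words (\<le>) m n' (Suc s). v ! s = m}" by auto
    then show ?thesis by blast
  qed
  moreover have "inj_on (insert_at (Suc s) m) {w \<in> sorted_prefix_words (\<le>) m n' (Suc s). w ! s = m}"
    by (rule inj_on_insert_at) (use sub in \<open>auto intro: Suc_leI\<close>)
  ultimately have "card {w \<in> sorted_prefix_words (\<le>) m n (Suc (Suc s)). w ! s = m \<and> w ! Suc s = m}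
      = card {w \<in> sorted_prefix_words (\<le>) m n' (Suc s). w ! s = m}"
    by (simp add: card_image)
  then show ?thesis using card_ascending_top_at[OF assms, of n' s] Suc by auto
qed

text \<open>Let the longest increasing prefix have length exactly \<open>s + 1\<close>. If the largest letter occurs at all,
  the letters before its first occurrence are increasing, so it already occurs within the prefix and
  hence, by monotonicity, ends it. The next letter is then not largest, as it would prolong the prefix.
  Conversely, a prefix that ends in the largest letter can only be prolonged by the same letter.\<close>
lemma ascending_exact_prefix:
  "sorted_prefix_words (\<le>) (Suc k) n (Suc s) - sorted_prefix_words (\<le>) (Suc k) n (Suc (Suc s)) =
   (sorted_prefix_words (\<le>) k n (Suc s) - sorted_prefix_words (\<le>) k n (Suc (Suc s))) \<union>
   ({w \<in> sorted_prefix_words (\<le>) (Suc k) n (Suc s). w ! s = Suc k} -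
    {w \<in> sorted_prefix_words (\<le>) (Suc k) n (Suc (Suc s)). w ! s = Suc k \<and> w ! Suc s = Suc k})"
  (is "?W - ?W' = ?V \<union> (?I - ?J)")
proof (rule set_eqI)
  fix w
  show "w \<in> ?W - ?W' \<longleftrightarrow> w \<in> ?V \<union> (?I - ?J)"
  proof (cases "w \<in> ?W")
    case False
    then show ?thesis by (auto simp: sorted_prefix_words_alphabet[of w _ k])
  next
    case W: True
    then have len: "length w = n" "s < n" and le: "set w \<subseteq> {1..Suc k}"
      and srt: "sorted_wrt (\<le>) (take (Suc s) w)"
      by (auto simp: sorted_prefix_words_def)
    \<comment> \<open>If the first largest letter stood beyond the prefix, the increasing letters before it, followed by it, would form a longer increasing prefix.\<close>
    have top: "w ! s = Suc k" if in_w: "Suc k \<in> set w" and not_W': "w \<notin> ?W'"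
    proof -
      obtain p where p: "p < n" "w ! p = Suc k" "sorted_wrt (\<le>) (take p w)"
        using sorted_before_first_max[OF W in_w] by blast
      have "p \<le> s"
      proof (rule ccontr)
        assume "\<not> p \<le> s"
        then have "Suc (Suc s) \<le> Suc p" by simp
        moreover have "w \<in> sorted_prefix_words (\<le>) (Suc k) n (Suc p)"
          using W p le len by (auto simp: sorted_prefix_words_def take_Suc_conv_app_nth
              sorted_wrt_append dest!: in_set_takeD)
        ultimately show False using not_W' sorted_prefix_words_antimono by blast
      qed
      then have "w ! p \<le> w ! s"
        using srt len by (cases "p = s") (auto simp: sorted_wrt_iff_nth_less)
      moreover have "w ! s \<le> Suc k" using le len nth_mem[of s w] by fastforce
      ultimately show ?thesis using p by simp
    qed
    have "w ! Suc s = Suc k" if "w \<in> ?W'" "w ! s = Suc k"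
    proof -
      have "Suc s < n" "sorted_wrt (\<le>) (take (Suc (Suc s)) w)"
        using that by (auto simp: sorted_prefix_words_def)
      then have "w ! s \<le> w ! Suc s" using len by (auto simp: sorted_wrt_iff_nth_less)
      moreover have "w ! Suc s \<le> Suc k" using le len nth_mem[of "Suc s" w] \<open>Suc s < n\<close> by fastforce
      ultimately show ?thesis using that by simp
    qed
    moreover have "Suc k \<in> set w" if "w ! s = Suc k" using that nth_mem[of s w] len by auto
    ultimately show ?thesis using W top by (auto simp: sorted_prefix_words_alphabet[of w _ k])
  qed
qed

text \<open>Words whose prefix ends in a largest letter arise by one insertion, and those where another largest
  letter follows by two. This explains the terms for lengths \<open>n - 1\<close> and \<open>n - 2\<close>.\<close>
lemma prefix_count_ascending_recurrence: "top_letter_recurrence (prefix_count (\<le>))"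
  unfolding top_letter_recurrence_def
proof (intro allI)
  fix k n s
  let ?W = "sorted_prefix_words (\<le>) (Suc k) n (Suc s)"
  let ?W' = "sorted_prefix_words (\<le>) (Suc k) n (Suc (Suc s))"
  let ?V = "sorted_prefix_words (\<le>) k n (Suc s)"
  let ?V' = "sorted_prefix_words (\<le>) k n (Suc (Suc s))"
  let ?I = "{w \<in> ?W. w ! s = Suc k}"
  let ?J = "{w \<in> ?W'. w ! s = Suc k \<and> w ! Suc s = Suc k}"
  have sub: "?W' \<subseteq> ?W" "?V' \<subseteq> ?V" by (rule sorted_prefix_words_antimono; simp)+
  have "(?V - ?V') \<inter> (?I - ?J) = {}"
  proof -
    have "Suc k \<in> set w" if "w \<in> ?I" for w
      using that nth_mem[of s w] by (auto simp: sorted_prefix_words_def)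
    then show ?thesis by (auto simp: sorted_prefix_words_alphabet[of _ _ k])
  qed
  then have "card (?W - ?W') = card (?V - ?V') + card (?I - ?J)"
    unfolding ascending_exact_prefix by (intro card_Un_disjoint) auto
  moreover have "?J \<subseteq> ?I" using sub by auto
  ultimately have "real (card ?W) - card ?W' = real (card ?V) - card ?V' + real (card ?I) - card ?J"
    using sub by (simp add: card_Diff_real[symmetric])
  then show "prefix_count (\<le>) (Suc k) n (Suc s) - prefix_count (\<le>) (Suc k) n (Suc (Suc s)) =
     prefix_count (\<le>) k n (Suc s) - prefix_count (\<le>) k n (Suc (Suc s))
     + (if n \<ge> 1 then prefix_count (\<le>) (Suc k) (n - 1) s else 0) - (if n \<ge> 2 then prefix_count (\<le>) (Suc k) (n - 2) s else 0)"
    unfolding prefix_count_def by (simp add: card_ascending_top_at card_ascending_top_twice)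
qed

section \<open>The recurrence for the pattern 123\<close>

text \<open>In a weakly decreasing prefix the largest letters come first, so here a copy is removed from the
  front. A largest letter in front is smaller than no letter and creates no occurrence of 123.\<close>
lemma Cons_max_mem_descending:
  assumes "set w \<subseteq> {1..m}" "m \<ge> 1"
  shows "m # w \<in> sorted_prefix_words (\<ge>) m (Suc n) (Suc s) \<longleftrightarrow> w \<in> sorted_prefix_words (\<ge>) m n s"
proof -
  have "set (take s w) \<subseteq> {1..m}" using assms(1) by (auto dest: in_set_takeD)
  moreover have "sorted_below (\<ge>) (m # w) \<longleftrightarrow> sorted_below (\<ge>) w"
    using sorted_below_insert_max[of w m "(\<ge>)" "[]"] assms(1) by fastforce
  ultimately show ?thesis using assms by (auto simp: sorted_prefix_words_def)
qed

lemma card_descending_top_first: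
  assumes m: "m \<ge> 1"
  shows "card {w \<in> sorted_prefix_words (\<ge>) m n (Suc s). w ! 0 = m}
     = (if n \<ge> 1 then card (sorted_prefix_words (\<ge>) m (n - 1) s) else 0)"
proof (cases n)
  case 0
  then show ?thesis by (simp add: sorted_prefix_words_def)
next
  case (Suc n')
  have "w \<in> {w \<in> sorted_prefix_words (\<ge>) m n (Suc s). w ! 0 = m}
      \<longleftrightarrow> w \<in> (#) m ` sorted_prefix_words (\<ge>) m n' s" for w
  proof (cases w)
    case Nil
    then show ?thesis using Suc by (auto simp: sorted_prefix_words_def)
  next
    case (Cons x v)
    show ?thesis
    proof (cases "x = m \<and> set v \<subseteq> {1..m}")
      case True
      then show ?thesis using Cons Suc Cons_max_mem_descending[of v m n' s] m by auto
    next
      case False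
      then show ?thesis using Cons by (auto simp: sorted_prefix_words_def)
    qed
  qed
  then have "{w \<in> sorted_prefix_words (\<ge>) m n (Suc s). w ! 0 = m} = (#) m ` sorted_prefix_words (\<ge>) m n' s"
    by blast
  then show ?thesis using Suc by (simp add: card_image)
qed

text \<open>The words left over once those starting with the largest letter are counted.\<close>
definition descending_below_top :: "nat \<Rightarrow> nat \<Rightarrow> nat \<Rightarrow> nat list set" where
  "descending_below_top m n s = {w \<in> sorted_prefix_words (\<ge>) m n (Suc s). w ! 0 \<noteq> m}"

lemma descending_below_top_prefix:
  assumes "w \<in> descending_below_top m n s"
  shows "length w = n" "s < n" "set w \<subseteq> {1..m}" "sorted_wrt (\<ge>) (take (Suc s) w)" "\<And>t. t \<le> s \<Longrightarrow> w ! t < m"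
proof -
  show len: "length w = n" "s < n" "set w \<subseteq> {1..m}" and srt: "sorted_wrt (\<ge>) (take (Suc s) w)"
    using assms by (auto simp: descending_below_top_def sorted_prefix_words_def)
  fix t assume t: "t \<le> s"
  have "w ! t \<le> w ! 0"
    using srt t len by (cases "t = 0") (auto simp: sorted_wrt_iff_nth_less)
  moreover have "w ! 0 \<in> set w" using len by (intro nth_mem) simp
  then have "w ! 0 \<le> m" using len(3) by auto
  moreover have "w ! 0 \<noteq> m" using assms by (simp add: descending_below_top_def)
  ultimately show "w ! t < m" by simp
qed

text \<open>The largest letter cannot lie in a decreasing prefix that starts below it. The letters before its
  first occurrence are decreasing, so it comes immediately after the longest decreasing prefix.\<close>
lemma descending_below_top_exact:
  assumes w: "w \<in> descending_below_top m n s - descending_below_top m n (Suc s)" and m: "m \<in> set w"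
  shows "Suc s < n" "w ! Suc s = m"
proof -
  have wm: "w \<in> descending_below_top m n s" using w by simp
  note pre = descending_below_top_prefix[OF wm]
  obtain p where p: "p < n" "w ! p = m" "sorted_wrt (\<ge>) (take p w)"
    using sorted_before_first_max[of w "(\<ge>)" m n "Suc s"] wm m by (auto simp: descending_below_top_def)
  have "s < p" using p(2) pre(5)[of p] by (cases "p \<le> s") auto
  moreover have "\<not> Suc (Suc s) \<le> p"
  proof
    assume "Suc (Suc s) \<le> p"
    moreover have "w \<in> sorted_prefix_words (\<ge>) m n p"
      using wm p by (auto simp: descending_below_top_def sorted_prefix_words_def)
    ultimately have "w \<in> sorted_prefix_words (\<ge>) m n (Suc (Suc s))"
      using sorted_prefix_words_antimono by blast
    then show False using w by (simp add: descending_below_top_def)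
  qed
  ultimately have "p = Suc s" by simp
  then show "Suc s < n" "w ! Suc s = m" using p by auto
qed

text \<open>A largest letter placed after a decreasing prefix that starts below it cuts the prefix off at
  exactly this length, whatever the letters behind it are.\<close>
lemma insert_at_mem_descending:
  assumes v: "set v \<subseteq> {1..m}" "Suc s \<le> length v" and m: "m \<ge> 1"
  shows "insert_at (Suc s) m v \<in> descending_below_top m (Suc n) s - descending_below_top m (Suc n) (Suc s)
    \<longleftrightarrow> v \<in> descending_below_top m n s"
proof -
  let ?w = "insert_at (Suc s) m v"
  have eq: "?w \<in> descending_below_top m (Suc n) s \<longleftrightarrow> v \<in> descending_below_top m n s"
  proof -
    have "sorted_wrt (\<ge>) (take (Suc s) v) \<Longrightarrow> sorted_below (\<ge>) ?w = sorted_below (\<ge>) v"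
      using sorted_below_insert_at[OF v(1), of "(\<ge>)" "Suc s"] by (simp add: sorted_wrt_filter)
    then show ?thesis
      using v m by (auto simp: descending_below_top_def sorted_prefix_words_def)
  qed
  moreover have "?w \<notin> descending_below_top m (Suc n) (Suc s)"
    using descending_below_top_prefix(5)[of ?w m "Suc n" "Suc s" "Suc s"] v by auto
  ultimately show ?thesis by blast
qed

lemma card_descending_exact:
  assumes m: "m \<ge> 1"
  shows "card {w \<in> descending_below_top m n s - descending_below_top m n (Suc s). m \<in> set w}
     = (if n \<ge> 1 then card (descending_below_top m (n - 1) s) else 0)" (is "card (?Z n) = _")
proof (cases n)
  case 0
  then show ?thesis by (simp add: descending_below_top_def sorted_prefix_words_def)
next
  case (Suc n')
  have "w \<in> ?Z n \<longleftrightarrow> w \<in> insert_at (Suc s) m ` descending_below_top m n' s" for w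
  proof
    assume w: "w \<in> ?Z n"
    then have top: "Suc s < n" "w ! Suc s = m" and len: "length w = n" "set w \<subseteq> {1..m}"
      using descending_below_top_exact[of w m n s] descending_below_top_prefix[of w m n s] by auto
    obtain v where v: "w = insert_at (Suc s) m v" "Suc s \<le> length v"
      using delete_at_cases[of "Suc s" w] top len by metis
    have "set v \<subseteq> {1..m}" using len(2) v by auto
    then show "w \<in> insert_at (Suc s) m ` descending_below_top m n' s"
      using w v Suc insert_at_mem_descending[of v m s n'] m by auto
  next
    assume "w \<in> insert_at (Suc s) m ` descending_below_top m n' s"
    then obtain v where v: "w = insert_at (Suc s) m v" "v \<in> descending_below_top m n' s" by blast
    then have "set v \<subseteq> {1..m}" "Suc s \<le> length v"
      using descending_below_top_prefix[OF v(2)] by auto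
    then show "w \<in> ?Z n" using v insert_at_mem_descending[of v m s n'] m Suc by auto
  qed
  then have "?Z n = insert_at (Suc s) m ` descending_below_top m n' s" by blast
  moreover have "inj_on (insert_at (Suc s) m) (descending_below_top m n' s)"
    by (rule inj_on_insert_at) (use descending_below_top_prefix in fastforce)
  ultimately show ?thesis using Suc by (simp add: card_image)
qed

lemma finite_descending_below_top [simp]: "finite (descending_below_top m n s)"
  by (simp add: descending_below_top_def)

lemma card_descending_below_top:
  assumes "m \<ge> 1"
  shows "real (card (descending_below_top m n s)) =
    prefix_count (\<ge>) m n (Suc s) - (if n \<ge> 1 then prefix_count (\<ge>) m (n - 1) s else 0)"
proof -
  let ?W = "sorted_prefix_words (\<ge>) m n (Suc s)"
  have "descending_below_top m n s = ?W - {w \<in> ?W. w ! 0 = m}"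
    by (auto simp: descending_below_top_def)
  then have "real (card (descending_below_top m n s)) = real (card ?W) - card {w \<in> ?W. w ! 0 = m}"
    by (simp add: card_Diff_real)
  then show ?thesis by (simp add: card_descending_top_first[OF assms] prefix_count_def)
qed

text \<open>For a fixed exact length of the decreasing prefix, either the largest letter is absent, or it follows the prefix and can be deleted there.\<close>
lemma descending_below_top_step:
  "real (card (descending_below_top (Suc k) n s)) - card (descending_below_top (Suc k) n (Suc s)) =
   prefix_count (\<ge>) k n (Suc s) - prefix_count (\<ge>) k n (Suc (Suc s)) +
   (if n \<ge> 1 then card (descending_below_top (Suc k) (n - 1) s) else 0)"
proof -
  let ?Y = "descending_below_top (Suc k) n s"
  let ?Y' = "descending_below_top (Suc k) n (Suc s)"
  let ?V = "sorted_prefix_words (\<ge>) k n (Suc s)"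
  let ?V' = "sorted_prefix_words (\<ge>) k n (Suc (Suc s))"
  let ?Z = "{w \<in> ?Y - ?Y'. Suc k \<in> set w}"
  have sub: "?Y' \<subseteq> ?Y" "?V' \<subseteq> ?V"
    using sorted_prefix_words_antimono[of "Suc s" "Suc (Suc s)"] by (auto simp: descending_below_top_def)
  have "?Y - ?Y' = (?V - ?V') \<union> ?Z"
  proof -
    have "w ! 0 \<noteq> Suc k" if "Suc k \<notin> set w" "w \<in> sorted_prefix_words (\<ge>) (Suc k) n (Suc s)" for w
      using that by (cases w) (auto simp: sorted_prefix_words_def)
    then show ?thesis
      by (auto simp: descending_below_top_def sorted_prefix_words_alphabet[of _ _ k])
  qed
  moreover have "card ((?V - ?V') \<union> ?Z) = card (?V - ?V') + card ?Z"
    by (rule card_Un_disjoint) (auto simp: sorted_prefix_words_alphabet[of _ _ k])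
  ultimately have "card (?Y - ?Y') = card (?V - ?V') + card ?Z" by (simp only:)
  then have "real (card ?Y) - card ?Y' = real (card ?V) - card ?V' + real (card ?Z)"
    using sub by (simp add: card_Diff_real[symmetric])
  moreover have "card ?Z = (if n \<ge> 1 then card (descending_below_top (Suc k) (n - 1) s) else 0)"
    by (rule card_descending_exact) simp
  ultimately show ?thesis by (simp only: prefix_count_def)
qed

text \<open>With \<open>y n s\<close> for the number of words with decreasing prefix of length \<open>s + 1\<close> that start below the
  largest letter, the two ways of removing a largest letter read
  \<open>c (k+1) n (s+1) = y n s + c (k+1) (n-1) s\<close> and
  \<open>y n s - y n (s+1) = c k n (s+1) - c k n (s+2) + y (n-1) s\<close>. Eliminating \<open>y\<close> yields the recurrence
  already found for 213.\<close>
lemma prefix_count_descending_recurrence: "top_letter_recurrence (prefix_count (\<ge>))"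
  unfolding top_letter_recurrence_def
proof (intro allI)
  fix k n s
  show "prefix_count (\<ge>) (Suc k) n (Suc s) - prefix_count (\<ge>) (Suc k) n (Suc (Suc s)) =
     prefix_count (\<ge>) k n (Suc s) - prefix_count (\<ge>) k n (Suc (Suc s))
     + (if n \<ge> 1 then prefix_count (\<ge>) (Suc k) (n - 1) s else 0)
     - (if n \<ge> 2 then prefix_count (\<ge>) (Suc k) (n - 2) s else 0)"
    using descending_below_top_step[of k n s]
    by (cases n; cases "n - 1") (simp_all add: card_descending_below_top algebra_simps)
qed

section \<open>Ballot numbers\<close>

unbundle fps_syntax

text \<open>The ballot numbers, as differences of binomials by the reflection principle. They are the
  coefficients of \<open>z^s * C(z)^(s+1)\<close>, where \<open>C\<close> is the Catalan series. At \<open>M = 0 < s\<close> the truncated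
  subtraction would yield 1 instead of 0, hence the case distinction.\<close>
definition ballot :: "nat \<Rightarrow> nat \<Rightarrow> real" where
  "ballot M s = (if s \<le> M then real ((2 * M - s) choose M) - real ((2 * M - s) choose Suc M) else 0)"

lemma ballot_0_0 [simp]: "ballot 0 0 = 1"
  by (simp add: ballot_def)

lemma ballot_outside [simp]: "M < s \<Longrightarrow> ballot M s = 0"
  by (simp add: ballot_def)

text \<open>This is \<open>z^(s+1) * C^(s+2) = z * (z^s * C^(s+1)) + z^(s+2) * C^(s+3)\<close>, a multiple of
  \<open>C = 1 + z * C^2\<close>; on the binomials it is Pascal's rule.\<close>
lemma ballot_step: "ballot (Suc M) (Suc s) = ballot M s + ballot (Suc M) (Suc (Suc s))"
proof -
  consider "s > M" | "s = M" | "s < M" by linarith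
  then show ?thesis
  proof cases
    case 3
    define N where "N = 2 * M - s"
    have "2 * Suc M - Suc s = Suc N" "2 * Suc M - Suc (Suc s) = N" using 3 by (auto simp: N_def)
    then show ?thesis using 3 by (simp add: ballot_def N_def[symmetric])
  qed (auto simp: ballot_def)
qed

lemma ballot_Suc_0: "ballot (Suc M) 0 = ballot (Suc M) (Suc 0)"
proof -
  have "Suc (2 * M) choose M = Suc (2 * M) choose Suc M"
    using binomial_symmetric[of M "Suc (2 * M)"] by simp
  then show ?thesis by (simp add: ballot_def)
qed

lemma ballot_0_eq_Catalan: "real (Suc M) * ballot M 0 = real ((2 * M) choose M)"
proof -
  have "Suc M * ((2 * M) choose Suc M) = (2 * M - M) * ((2 * M) choose M)"
    by (simp only: binomial_absorption binomial_absorb_comp)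
  then have "Suc M * ((2 * M) choose Suc M) = M * ((2 * M) choose M)" by simp
  then have "real (Suc M) * real ((2 * M) choose Suc M) = real M * real ((2 * M) choose M)"
    by (metis of_nat_mult)
  then show ?thesis by (simp add: ballot_def algebra_simps)
qed

text \<open>The binomial is \<open>(M + k - 1) choose M\<close> rather than \<open>(M + k - 1) choose (k - 1)\<close> so that it also has
  the right values for \<open>k = 0\<close>, namely 1 at \<open>M = 0\<close> and 0 elsewhere.\<close>
definition ballot_series :: "nat \<Rightarrow> nat \<Rightarrow> real fps" where
  "ballot_series k s = Abs_fps (\<lambda>M. ballot M s * real ((M + k - 1) choose M))"

text \<open>In the difference of two consecutive \<open>s\<close> the ballot numbers step from \<open>M\<close> to \<open>M - 1\<close>, and in the
  difference of two consecutive \<open>k\<close> so do the binomials, by Pascal's rule. Both steps together shift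
  the series by one power of the variable.\<close>
lemma ballot_series_step:
  "ballot_series (Suc k) (Suc s) - ballot_series (Suc k) (Suc (Suc s)) =
   ballot_series k (Suc s) - ballot_series k (Suc (Suc s)) + fps_X * ballot_series (Suc k) s"
proof (rule fps_ext)
  fix M
  show "(ballot_series (Suc k) (Suc s) - ballot_series (Suc k) (Suc (Suc s))) $ M =
   (ballot_series k (Suc s) - ballot_series k (Suc (Suc s)) + fps_X * ballot_series (Suc k) s) $ M"
    by (cases M) (simp_all add: ballot_series_def ballot_step[of _ s] algebra_simps)
qed

lemma ballot_series_empty: "ballot_series k 0 - ballot_series k (Suc 0) = 1"
proof (rule fps_ext)
  fix M
  show "(ballot_series k 0 - ballot_series k (Suc 0)) $ M = 1 $ M"
    by (cases M) (simp_all add: ballot_series_def ballot_Suc_0)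
qed

lemma ballot_series_no_letters: "ballot_series 0 (Suc s) = 0"
proof (rule fps_ext)
  fix M
  show "ballot_series 0 (Suc s) $ M = 0 $ M"
    by (cases M) (simp_all add: ballot_series_def)
qed

section \<open>The solution of the recurrence\<close>

definition word_series :: "nat \<Rightarrow> nat \<Rightarrow> real fps" where
  "word_series k s = ballot_series k s oo (fps_X - fps_X^2)"

lemma word_series_step:
  "word_series (Suc k) (Suc s) - word_series (Suc k) (Suc (Suc s)) =
   word_series k (Suc s) - word_series k (Suc (Suc s)) + (fps_X - fps_X^2) * word_series (Suc k) s"
  using arg_cong[OF ballot_series_step[of k s], of "\<lambda>f. f oo (fps_X - fps_X^2)"]
  by (simp add: word_series_def fps_compose_sub_distrib fps_compose_add_distrib fps_compose_mult_distrib)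

lemma word_series_outside:
  assumes "n < s" shows "word_series k s $ n = 0"
  using assms by (simp add: word_series_def fps_compose_nth ballot_series_def)

text \<open>The recurrence expresses the value at \<open>s + 1\<close> by the values at \<open>s + 2\<close>, at shorter lengths, and for
  a smaller alphabet. This is well founded because the values vanish for \<open>s > n\<close>: the induction is on
  \<open>k\<close>, then \<open>n\<close>, then downwards on \<open>s\<close>.\<close>
lemma recurrence_unique:
  assumes rec: "top_letter_recurrence c"
    and empty: "\<And>k n. c k n 0 - c k n (Suc 0) = (if n = 0 then 1 else 0)"
    and none: "\<And>n s. c 0 n (Suc s) = 0"
    and long: "\<And>k n s. n < s \<Longrightarrow> c k n s = 0"
  shows "c k n s = word_series k s $ n"
proof -
  have at_0: "c k n 0 = word_series k 0 $ n" if "c k n 1 = word_series k 1 $ n" for k n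
  proof -
    have "word_series k 0 - word_series k 1 = 1"
      using arg_cong[OF ballot_series_empty[of k], of "\<lambda>f. f oo (fps_X - fps_X^2)"]
      by (simp add: word_series_def fps_compose_sub_distrib)
    then have "word_series k 0 $ n - word_series k 1 $ n = (if n = 0 then 1 else 0)"
      by (metis fps_one_nth fps_sub_nth)
    then show ?thesis using empty[of k n] that by simp
  qed
  show ?thesis
  proof (induction k arbitrary: n s)
    case 0
    have "c 0 n (Suc t) = word_series 0 (Suc t) $ n" for t n
      by (simp add: none word_series_def ballot_series_no_letters)
    then show ?case using at_0[of 0 n] by (cases s) auto
  next
    case (Suc k)
    show ?case
    proof (induction n arbitrary: s rule: less_induct)
      case (less n)
      have pos: "c (Suc k) n (Suc t) = word_series (Suc k) (Suc t) $ n" for t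
      proof (induction "n - t" arbitrary: t rule: less_induct)
        case less': less
        show ?case
        proof (cases "t < n")
          case False
          then show ?thesis using long[of n "Suc t"] word_series_outside[of n "Suc t"] by simp
        next
          case True
          have next_t: "c (Suc k) n (Suc (Suc t)) = word_series (Suc k) (Suc (Suc t)) $ n"
            using less'[of "Suc t"] True by simp
          have "((fps_X - fps_X^2) * word_series (Suc k) t) $ n =
             (if n \<ge> 1 then word_series (Suc k) t $ (n - 1) else 0)
             - (if n \<ge> 2 then word_series (Suc k) t $ (n - 2) else 0)"
            by (simp add: left_diff_distrib fps_X_power_mult_nth)
          then have "word_series (Suc k) (Suc t) $ n - word_series (Suc k) (Suc (Suc t)) $ n =
             word_series k (Suc t) $ n - word_series k (Suc (Suc t)) $ n
             + (if n \<ge> 1 then word_series (Suc k) t $ (n - 1) else 0)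
             - (if n \<ge> 2 then word_series (Suc k) t $ (n - 2) else 0)"
            using arg_cong[OF word_series_step[of k t], of "\<lambda>f. f $ n"] by simp
          moreover have "c (Suc k) n (Suc t) - c (Suc k) n (Suc (Suc t)) =
             c k n (Suc t) - c k n (Suc (Suc t))
             + (if n \<ge> 1 then c (Suc k) (n - 1) t else 0)
             - (if n \<ge> 2 then c (Suc k) (n - 2) t else 0)"
            using rec by (simp only: top_letter_recurrence_def)
          ultimately show ?thesis
            using next_t Suc.IH less.IH[of "n - 1" t] less.IH[of "n - 2" t] True
            by (auto split: if_splits)
        qed
      qed
      then show ?case using at_0[of "Suc k" n] by (cases s) auto
    qed
  qed
qed

lemma prefix_count_eq_word_series:
  assumes "top_letter_recurrence (prefix_count R)"
  shows "prefix_count R k n s = word_series k s $ n"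
proof (rule recurrence_unique[OF assms])
  fix k n
  show "prefix_count R k n 0 - prefix_count R k n (Suc 0) = (if n = 0 then 1 else 0)"
  proof (cases n)
    case 0
    have "sorted_prefix_words R k 0 0 = {[]}" "sorted_prefix_words R k 0 (Suc 0) = {}"
      by (auto simp: sorted_prefix_words_def)
    then show ?thesis using 0 by (simp add: prefix_count_def)
  next
    case (Suc n')
    have "sorted_wrt R (take (Suc 0) w)" for w by (cases w) auto
    then have "sorted_prefix_words R k n 0 = sorted_prefix_words R k n (Suc 0)"
      using Suc by (simp add: sorted_prefix_words_def)
    then show ?thesis using Suc by (simp add: prefix_count_def)
  qed
next
  fix n s
  have "sorted_prefix_words R 0 n (Suc s) = {}" by (auto simp: sorted_prefix_words_def)
  then show "prefix_count R 0 n (Suc s) = 0" by (simp add: prefix_count_def)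
next
  fix k n s :: nat
  assume "n < s"
  then have "sorted_prefix_words R k n s = {}" by (auto simp: sorted_prefix_words_def)
  then show "prefix_count R k n s = 0" by (simp add: prefix_count_def)
qed

text \<open>The words 213 and 123 are counted directly; 321 and 312 are their reversals, 231 is the complement
  of 213, and 132 is the reversal of 231.\<close>
lemma card_avoiding_words:
  assumes "p permutes {1, 2, 3}"
  shows "real (card (avoiding_words k n p)) = word_series k 0 $ n"
proof -
  have c123: "real (card (avoiding_words k n p)) = word_series k 0 $ n"
    if "p 1 = 1" "p 2 = 2" "p 3 = 3" for p
  proof -
    have "avoiding_words k n p = sorted_prefix_words (\<ge>) k n 0"
      by (simp add: avoiding_words_def sorted_prefix_words_def avoids_123_iff[of p, OF that])
    then show ?thesis
      using prefix_count_eq_word_series[OF prefix_count_descending_recurrence, of k n 0]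
      by (simp add: prefix_count_def)
  qed
  have c213: "real (card (avoiding_words k n p)) = word_series k 0 $ n"
    if "p 1 = 2" "p 2 = 1" "p 3 = 3" for p
  proof -
    have "avoiding_words k n p = sorted_prefix_words (\<le>) k n 0"
      by (simp add: avoiding_words_def sorted_prefix_words_def avoids_213_iff[of p, OF that])
    then show ?thesis
      using prefix_count_eq_word_series[OF prefix_count_ascending_recurrence, of k n 0]
      by (simp add: prefix_count_def)
  qed
  define pat :: "nat \<Rightarrow> nat \<Rightarrow> nat \<Rightarrow> nat \<Rightarrow> nat"
    where "pat x y z i = (if i = 1 then x else if i = 2 then y else z)" for x y z i
  have pat: "pat x y z 1 = x" "pat x y z 2 = y" "pat x y z 3 = z" for x y z
    by (simp_all add: pat_def)
  have p123: "real (card (avoiding_words k n (pat 1 2 3))) = word_series k 0 $ n"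
    by (rule c123) (simp_all only: pat)
  have p213: "real (card (avoiding_words k n (pat 2 1 3))) = word_series k 0 $ n"
    by (rule c213) (simp_all only: pat)
  have p231: "real (card (avoiding_words k n q)) = word_series k 0 $ n"
    if "q 1 = 2" "q 2 = 3" "q 3 = 1" for q
  proof -
    have "card (avoiding_words k n q) = card (avoiding_words k n (pat 2 1 3))"
      by (rule card_avoiding_words_complement) (use that in \<open>simp_all add: pat_def\<close>)
    then show ?thesis using p213 by simp
  qed
  have p231': "real (card (avoiding_words k n (pat 2 3 1))) = word_series k 0 $ n"
    by (rule p231) (simp_all only: pat)
  show ?thesis
    using assms
  proof (cases rule: permutation_3_cases)
    case 1
    then show ?thesis by (rule c123)
  next
    case 2
    have "card (avoiding_words k n p) = card (avoiding_words k n (pat 1 2 3))"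
      by (rule card_avoiding_words_rev) (simp_all only: 2 pat)
    then show ?thesis using p123 by simp
  next
    case 3
    then show ?thesis by (rule c213)
  next
    case 4
    have "card (avoiding_words k n p) = card (avoiding_words k n (pat 2 1 3))"
      by (rule card_avoiding_words_rev) (simp_all only: 4 pat)
    then show ?thesis using p213 by simp
  next
    case 5
    then show ?thesis by (rule p231)
  next
    case 6
    have "card (avoiding_words k n p) = card (avoiding_words k n (pat 2 3 1))"
      by (rule card_avoiding_words_rev) (simp_all only: 6 pat)
    then show ?thesis using p231' by simp
  qed
qed

section \<open>The closed form\<close>

text \<open>This is the power series of \<open>(1 - 4 z)^(-1/2)\<close>.\<close>
definition central_binomial_series :: "real fps" where
  "central_binomial_series = Abs_fps (\<lambda>m. real ((2 * m) choose m))"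

lemma central_binomial_Suc:
  "real (Suc m) * real ((2 * Suc m) choose Suc m) = 2 * (2 * real m + 1) * real ((2 * m) choose m)"
proof -
  have "Suc m * ((2 * Suc m) choose Suc m) = Suc (Suc (2 * m)) * (Suc (2 * m) choose m)"
    using Suc_times_binomial_eq[of "Suc (2 * m)" m] by (simp add: mult.commute del: binomial_Suc_Suc)
  also have "\<dots> = 2 * (Suc m * (Suc (2 * m) choose m))" by (simp add: algebra_simps)
  also have "Suc m * (Suc (2 * m) choose m) = Suc (2 * m) * ((2 * m) choose m)"
    using binomial_absorb_comp[of "Suc (2 * m)" m] by simp
  finally have "Suc m * ((2 * Suc m) choose Suc m) = 2 * (Suc (2 * m) * ((2 * m) choose m))" .
  then have "real (Suc m * ((2 * Suc m) choose Suc m)) = real (2 * (Suc (2 * m) * ((2 * m) choose m)))"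
    by (simp only:)
  then show ?thesis by (simp add: algebra_simps del: binomial_Suc_Suc)
qed

lemma central_binomial_deriv:
  "(1 - 4 * fps_X) * fps_deriv central_binomial_series = 2 * central_binomial_series"
proof (rule fps_ext)
  fix m
  have "fps_deriv central_binomial_series $ m - 4 * (fps_X * fps_deriv central_binomial_series) $ m
      = 2 * central_binomial_series $ m"
    using central_binomial_Suc[of m]
    by (cases m) (simp_all add: central_binomial_series_def algebra_simps del: binomial_Suc_Suc)
  then show "((1 - 4 * fps_X) * fps_deriv central_binomial_series) $ m = (2 * central_binomial_series) $ m"
    by (simp add: left_diff_distrib mult.assoc numeral_fps_const)
qed

text \<open>By the differential equation the derivative of the left-hand side vanishes, so it equals its constant
  coefficient.\<close>
lemma central_binomial_square: "central_binomial_series ^ 2 * (1 - 4 * fps_X) = 1"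
proof -
  let ?R = central_binomial_series
  have "fps_deriv (?R ^ 2 * (1 - 4 * fps_X)) = 2 * ?R * ((1 - 4 * fps_X) * fps_deriv ?R) - 4 * ?R ^ 2"
    by (simp add: power2_eq_square algebra_simps)
  also have "\<dots> = 0" by (simp only: central_binomial_deriv) (simp add: power2_eq_square)
  finally have "?R ^ 2 * (1 - 4 * fps_X) = fps_const ((?R ^ 2 * (1 - 4 * fps_X)) $ 0)"
    by (simp only: fps_deriv_eq_0_iff)
  also have "(?R ^ 2 * (1 - 4 * fps_X)) $ 0 = 1"
    by (simp add: central_binomial_series_def fps_power_zeroth)
  finally show ?thesis by simp
qed

text \<open>With \<open>R = (1 - 4 z)^(-1/2)\<close> one has \<open>R' = 2 * R^3\<close> and \<open>4 * z * R^2 = R^2 - 1\<close>. So \<open>2 * z d/dz\<close> sends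
  an odd power of \<open>R\<close> to a combination of itself and the next odd power.\<close>
lemma euler_central_binomial_power:
  "2 * fps_X * fps_deriv (central_binomial_series ^ (2 * j + 1)) =
   of_nat (2 * j + 1) * (central_binomial_series ^ (2 * j + 3) - central_binomial_series ^ (2 * j + 1))"
proof -
  let ?R = central_binomial_series
  have inv: "?R ^ 2 * (1 - 4 * fps_X) = 1" by (rule central_binomial_square)
  have "fps_deriv ?R = ?R ^ 2 * ((1 - 4 * fps_X) * fps_deriv ?R)"
    using inv by (simp add: mult.assoc[symmetric])
  then have dR: "fps_deriv ?R = 2 * ?R ^ 3"
    by (simp only: central_binomial_deriv) (simp add: power2_eq_square power3_eq_cube)
  have X: "4 * fps_X * ?R ^ 2 = ?R ^ 2 - 1" using inv by (simp add: algebra_simps)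
  have "fps_deriv (?R ^ (2 * j + 1)) = of_nat (2 * j + 1) * fps_deriv ?R * ?R ^ (2 * j)"
    using fps_deriv_power[of ?R "2 * j + 1"] by (simp only: fps_of_nat add_diff_cancel_right')
  then have "2 * fps_X * fps_deriv (?R ^ (2 * j + 1)) = of_nat (2 * j + 1) * ((4 * fps_X * ?R ^ 2) * ?R ^ (2 * j + 1))"
  proof -
    have "2 * fps_X * (N * (2 * r ^ 3) * P) = N * ((4 * fps_X * r ^ 2) * (P * r))" for N r P :: "real fps"
      by (simp add: power2_eq_square power3_eq_cube mult_ac)
    then show ?thesis using \<open>fps_deriv (?R ^ (2 * j + 1)) = _\<close>
      by (simp only: dR power_add power_one_right)
  qed
  then show ?thesis unfolding X by (simp add: algebra_simps power_add power3_eq_cube power2_eq_square)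
qed

text \<open>The summand of the final formula with \<open>K = k - 2\<close> and without its dependence on \<open>n\<close>, continued by 0
  to \<open>j > K\<close> so that the recurrence in \<open>K\<close> holds for all \<open>j\<close>.\<close>
definition closed_form_coeff :: "nat \<Rightarrow> nat \<Rightarrow> real" where
  "closed_form_coeff K j = (if j \<le> K then
     (2 * real (K - j) + 1) * real ((2 * j) choose j) * real ((2 * (K - j)) choose (K - j)) else 0)"

text \<open>With \<open>i = K + 1 - j\<close> and \<open>c m\<close> the central binomial coefficients, the rule
  \<open>(m + 1) * c (m + 1) = 2 * (2 m + 1) * c m\<close> turns the two terms on the right into \<open>j\<close> and \<open>i\<close> times
  \<open>(2 i + 1) * c i * c j\<close>, and \<open>i + j = K + 1\<close>.\<close>
lemma closed_form_coeff_Suc: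
  "real (K + 1) * closed_form_coeff (Suc K) j =
     2 * (2 * real j - 1) * (if j = 0 then 0 else closed_form_coeff K (j - 1))
     + 2 * (2 * real K + 3 - 2 * real j) * closed_form_coeff K j"
proof (cases "j \<le> Suc K")
  case True
  then obtain i where i: "Suc K = i + j" by (metis add.commute le_Suc_ex)
  define c where "c m = real ((2 * m) choose m)" for m
  have c: "real (Suc m) * c (Suc m) = 2 * (2 * real m + 1) * c m" for m
    unfolding c_def by (rule central_binomial_Suc)
  have here: "2 * (2 * real K + 3 - 2 * real j) * closed_form_coeff K j = real i * (2 * real i + 1) * c i * c j"
  proof (cases i)
    case (Suc i')
    then have K: "K = i' + j" using i by simp
    have "2 * (2 * real K + 3 - 2 * real j) * closed_form_coeff K j
       = (2 * real i' + 3) * (2 * (2 * real i' + 1) * c i') * c j"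
      using K by (simp add: closed_form_coeff_def c_def algebra_simps)
    then show ?thesis unfolding c[symmetric] using Suc by (simp add: algebra_simps)
  qed (use i in \<open>simp add: closed_form_coeff_def\<close>)
  have prev: "2 * (2 * real j - 1) * (if j = 0 then 0 else closed_form_coeff K (j - 1))
      = real j * (2 * real i + 1) * c i * c j"
  proof (cases j)
    case (Suc j')
    then have K: "K = i + j'" using i by simp
    have "2 * (2 * real j - 1) * closed_form_coeff K (j - 1)
       = (2 * real i + 1) * (2 * (2 * real j' + 1) * c j') * c i"
      using K Suc by (simp add: closed_form_coeff_def c_def algebra_simps)
    then show ?thesis unfolding c[symmetric] using Suc by (simp add: algebra_simps)
  qed simp
  have "closed_form_coeff (Suc K) j = (2 * real i + 1) * c j * c i"
    using i by (simp add: closed_form_coeff_def c_def)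
  moreover have "real (K + 1) = real i + real j" using i by simp
  ultimately show ?thesis unfolding here prev by (simp add: algebra_simps)
next
  case False
  then show ?thesis by (cases j) (auto simp: closed_form_coeff_def)
qed

text \<open>Coefficientwise this is \<open>(K + 2) * ((M + K + 2) choose M) = (M + K + 2) * ((M + K + 1) choose M)\<close>,
  the operator \<open>z d/dz\<close> contributing the factor \<open>M\<close>.\<close>
lemma ballot_series_euler:
  "of_nat (K + 2) * ballot_series (K + 3) 0 =
   fps_X * fps_deriv (ballot_series (K + 2) 0) + of_nat (K + 2) * ballot_series (K + 2) 0"
proof (rule fps_ext)
  fix M
  have "(K + 2) * ((M + K + 2) choose M) = (M + K + 2) * ((M + K + 1) choose M)"
    using binomial_absorb_comp[of "M + K + 2" M] by simp
  then have "real (K + 2) * real ((M + K + 2) choose M) = real (M + K + 2) * real ((M + K + 1) choose M)"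
    by (metis of_nat_mult)
  then have "real (K + 2) * (ballot M 0 * real ((M + K + 2) choose M))
      = (real M + real (K + 2)) * (ballot M 0 * real ((M + K + 1) choose M))"
    by (simp add: algebra_simps)
  moreover have "(fps_X * fps_deriv (ballot_series (K + 2) 0)) $ M = real M * ballot_series (K + 2) 0 $ M"
    by (cases M) auto
  ultimately show "(of_nat (K + 2) * ballot_series (K + 3) 0) $ M =
      (fps_X * fps_deriv (ballot_series (K + 2) 0) + of_nat (K + 2) * ballot_series (K + 2) 0) $ M"
    unfolding fps_of_nat[symmetric] fps_add_nth fps_mult_left_const_nth
    by (simp add: ballot_series_def numeral_3_eq_3 distrib_right del: of_nat_add of_nat_Suc)
qed

text \<open>Induction on \<open>K\<close>: for \<open>K = 0\<close> the factor \<open>M + 1\<close> turns Catalan numbers into central binomial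
  coefficients, and the step applies the operator \<open>z d/dz + K + 2\<close> to the odd powers of \<open>R\<close>.\<close>
lemma ballot_series_closed_form:
  "fps_const (real (K + 1) * 4 ^ K) * ballot_series (K + 2) 0 =
   (\<Sum>j\<le>K. fps_const (closed_form_coeff K j) * central_binomial_series ^ (2 * j + 1))"
proof (induction K)
  case 0
  have "real (Suc M) * ballot M 0 = real ((2 * M) choose M)" for M by (rule ballot_0_eq_Catalan)
  then have "ballot_series (Suc (Suc 0)) 0 = central_binomial_series"
    by (intro fps_ext) (simp add: ballot_series_def central_binomial_series_def mult.commute)
  then show ?case by (simp add: closed_form_coeff_def)
next
  case (Suc K)
  let ?R = central_binomial_series
  let ?c = "closed_form_coeff"
  let ?S = "ballot_series (K + 2) 0"
  define N where "N = real (K + 1) * 4 ^ K"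
  have IH: "fps_const N * ?S = (\<Sum>j\<le>K. fps_const (?c K j) * ?R ^ (2 * j + 1))"
    unfolding N_def by (rule Suc.IH)
  have euler: "2 * fps_X * fps_deriv (fps_const N * ?S) =
     (\<Sum>j\<le>K. fps_const (?c K j * real (2 * j + 1)) * (?R ^ (2 * j + 3) - ?R ^ (2 * j + 1)))"
  proof -
    have "2 * fps_X * fps_deriv (fps_const N * ?S) =
       (\<Sum>j\<le>K. fps_const (?c K j) * (2 * fps_X * fps_deriv (?R ^ (2 * j + 1))))"
      unfolding IH by (simp only: fps_deriv_sum fps_deriv_mult_const_left sum_distrib_left mult_ac)
    also have "\<dots> = (\<Sum>j\<le>K. fps_const (?c K j * real (2 * j + 1)) * (?R ^ (2 * j + 3) - ?R ^ (2 * j + 1)))"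
      by (simp only: euler_central_binomial_power fps_of_nat[symmetric] mult.assoc[symmetric] fps_const_mult)
    finally show ?thesis .
  qed
  have four: "fps_const (4 * x) = 4 * fps_const x" for x :: real
    by (simp only: numeral_fps_const fps_const_mult)
  have "real (K + 1) * (real (Suc K + 1) * 4 ^ Suc K) = 4 * N * real (K + 2)"
    by (simp add: N_def)
  moreover have "Suc K + 2 = K + 3" by simp
  ultimately have "fps_const (real (K + 1) * (real (Suc K + 1) * 4 ^ Suc K)) * ballot_series (Suc K + 2) 0
      = fps_const (4 * N) * (of_nat (K + 2) * ballot_series (K + 3) 0)"
    by (simp only: fps_of_nat[symmetric] fps_const_mult mult.assoc[symmetric])
  also have "\<dots> = 4 * fps_const N * (fps_X * fps_deriv ?S + of_nat (K + 2) * ?S)"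
    by (simp only: ballot_series_euler four)
  also have "\<dots> = 2 * (2 * fps_X * (fps_const N * fps_deriv ?S)) + 4 * of_nat (K + 2) * (fps_const N * ?S)"
  proof -
    have "4 * c * (fps_X * D + m * S) = 2 * (2 * fps_X * (c * D)) + 4 * m * (c * S)" for c D m S :: "real fps"
      by (simp add: algebra_simps)
    then show ?thesis .
  qed
  also have "\<dots> = 2 * (2 * fps_X * fps_deriv (fps_const N * ?S)) + fps_const (4 * real (K + 2)) * (fps_const N * ?S)"
    by (simp only: four fps_of_nat fps_deriv_mult_const_left)
  also have "\<dots> = (\<Sum>j\<le>K. fps_const (2 * ?c K j * real (2 * j + 1)) * ?R ^ (2 * Suc j + 1))
       + (\<Sum>j\<le>K. fps_const (2 * (2 * real K + 3 - 2 * real j) * ?c K j) * ?R ^ (2 * j + 1))"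
    unfolding euler unfolding IH sum_distrib_left sum.distrib[symmetric]
  proof (rule sum.cong[OF refl])
    fix j assume "j \<in> {..K}"
    have e: "2 * j + 3 = 2 * Suc j + 1" by simp
    show "2 * (fps_const (?c K j * real (2 * j + 1)) * (?R ^ (2 * j + 3) - ?R ^ (2 * j + 1)))
        + fps_const (4 * real (K + 2)) * (fps_const (?c K j) * ?R ^ (2 * j + 1))
      = fps_const (2 * ?c K j * real (2 * j + 1)) * ?R ^ (2 * Suc j + 1) +
        fps_const (2 * (2 * real K + 3 - 2 * real j) * ?c K j) * ?R ^ (2 * j + 1)"
      unfolding e
      by (rule fps_ext)
         (simp add: numeral_fps_const mult.assoc algebra_simps del: power_Suc)
  qed
  also have "(\<Sum>j\<le>K. fps_const (2 * ?c K j * real (2 * j + 1)) * ?R ^ (2 * Suc j + 1))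
     = (\<Sum>j\<le>Suc K. fps_const (2 * (2 * real j - 1) * (if j = 0 then 0 else ?c K (j - 1))) * ?R ^ (2 * j + 1))"
    by (subst sum.atMost_Suc_shift) (simp add: algebra_simps)
  also have "(\<Sum>j\<le>K. fps_const (2 * (2 * real K + 3 - 2 * real j) * ?c K j) * ?R ^ (2 * j + 1))
     = (\<Sum>j\<le>Suc K. fps_const (2 * (2 * real K + 3 - 2 * real j) * ?c K j) * ?R ^ (2 * j + 1))"
    by (simp add: closed_form_coeff_def)
  finally have "fps_const (real (K + 1) * (real (Suc K + 1) * 4 ^ Suc K)) * ballot_series (Suc K + 2) 0
    = (\<Sum>j\<le>Suc K. fps_const (real (K + 1) * ?c (Suc K) j) * ?R ^ (2 * j + 1))"
    by (simp only: closed_form_coeff_Suc sum.distrib[symmetric] distrib_right[symmetric] fps_const_add)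
  then have "fps_const (real (K + 1)) * (fps_const (real (Suc K + 1) * 4 ^ Suc K) * ballot_series (Suc K + 2) 0)
    = fps_const (real (K + 1)) * (\<Sum>j\<le>Suc K. fps_const (?c (Suc K) j) * ?R ^ (2 * j + 1))"
    by (simp only: fps_const_mult[symmetric] mult.assoc sum_distrib_left)
  moreover have "fps_const (real (K + 1)) \<noteq> 0" by (simp del: of_nat_add)
  ultimately show ?case by (rule mult_left_cancel[THEN iffD1, rotated])
qed

text \<open>Both sides have the same square, since \<open>1 - 4 * (x - x^2) = (1 - 2 * x)^2\<close>; the constant coefficient
  decides the sign.\<close>
lemma central_binomial_compose:
  "central_binomial_series oo (fps_X - fps_X ^ 2) = inverse (1 - 2 * fps_X)"
proof -
  let ?Q = "central_binomial_series oo (fps_X - fps_X ^ 2)"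
  have "(1 - 4 * fps_X) oo (fps_X - fps_X ^ 2 :: real fps) = (1 - 2 * fps_X) ^ 2"
    by (simp add: fps_compose_sub_distrib fps_compose_mult_distrib power2_eq_square algebra_simps
        numeral_fps_const)
  then have "?Q ^ 2 * (1 - 2 * fps_X) ^ 2 = 1"
    using arg_cong[OF central_binomial_square, of "\<lambda>f. f oo (fps_X - fps_X ^ 2)"]
    by (simp add: fps_compose_mult_distrib fps_compose_power)
  then have "(?Q * (1 - 2 * fps_X)) ^ 2 = 1" by (simp add: power_mult_distrib)
  then have "?Q * (1 - 2 * fps_X) = 1 \<or> ?Q * (1 - 2 * fps_X) = - 1" by (simp add: power2_eq_1_iff)
  moreover have "(?Q * (1 - 2 * fps_X)) $ 0 = 1" by (simp add: central_binomial_series_def)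
  then have "?Q * (1 - 2 * fps_X) \<noteq> - 1" by (metis fps_neg_nth fps_one_nth one_neq_neg_one)
  ultimately have "?Q * (1 - 2 * fps_X) = 1" by blast
  then show ?thesis by (metis fps_inverse_unique mult.commute)
qed

lemma word_series_closed_form:
  "real (K + 1) * 4 ^ K * word_series (K + 2) 0 $ n =
   2 ^ n * (\<Sum>j\<le>K. closed_form_coeff K j * real ((n + 2 * j) choose (2 * j)))"
proof -
  have power: "(inverse (1 - 2 * fps_X) ^ (2 * j + 1) :: real fps) $ n = 2 ^ n * real ((n + 2 * j) choose (2 * j))" for j
  proof -
    have "(inverse (1 - 2 * fps_X) ^ (2 * j + 1) :: real fps) = inverse ((1 - fps_const 2 * fps_X) ^ (2 * j + 1))"
      by (simp only: numeral_fps_const fps_inverse_power)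
    then have "(inverse (1 - 2 * fps_X) ^ (2 * j + 1) :: real fps) $ n = real ((2 * j + n) choose n) * 2 ^ n"
      by (subst (asm) one_minus_const_fps_X_neg_power') auto
    moreover have "(2 * j + n) choose n = (n + 2 * j) choose (2 * j)"
      using binomial_symmetric[of n "2 * j + n"] by (simp add: add.commute)
    ultimately show ?thesis by simp
  qed
  have "fps_const (real (K + 1) * 4 ^ K) * word_series (K + 2) 0 =
     (\<Sum>j\<le>K. fps_const (closed_form_coeff K j) * inverse (1 - 2 * fps_X) ^ (2 * j + 1))"
    using arg_cong[OF ballot_series_closed_form[of K], of "\<lambda>f. f oo (fps_X - fps_X ^ 2)"]
    by (simp add: word_series_def fps_compose_mult_distrib fps_compose_sum_distrib
        fps_compose_power[symmetric] central_binomial_compose del: power_Suc)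
  then have "(fps_const (real (K + 1) * 4 ^ K) * word_series (K + 2) 0) $ n =
     (\<Sum>j\<le>K. fps_const (closed_form_coeff K j) * inverse (1 - 2 * fps_X) ^ (2 * j + 1)) $ n"
    by (simp only:)
  then show ?thesis
    unfolding fps_sum_nth fps_mult_left_const_nth power
    by (simp add: sum_distrib_left mult_ac)
qed

theorem theorem3p3:
  fixes p :: "nat \<Rightarrow> nat" and k n :: nat
  assumes "p permutes {1, 2, 3}" and "k \<ge> 2"
  shows "real (card (avoiding_words k n p)) =
    2 powi (int n - 2 * (int k - 2)) / (real k - 1) *
    (\<Sum>j = 0..k - 2. (2 * real k - 2 * real j - 3) * real ((2 * j) choose j) *
       real ((2 * (k - 2 - j)) choose (k - 2 - j)) * real ((n + 2 * j) choose (2 * j)))"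
proof -
  obtain K where K: "k = K + 2" using assms(2) by (metis le_add_diff_inverse2)
  have "(2 :: real) powi (int n - 2 * (int k - 2)) = 2 powi int n / 2 powi int (2 * K)"
    using K by (subst power_int_diff[symmetric]) auto
  also have "\<dots> = 2 ^ n / 4 ^ K" by (simp only: power_int_of_nat power_mult) simp
  finally have pow: "(2 :: real) powi (int n - 2 * (int k - 2)) = 2 ^ n / 4 ^ K" .
  have "(\<Sum>j = 0..k - 2. (2 * real k - 2 * real j - 3) * real ((2 * j) choose j) *
       real ((2 * (k - 2 - j)) choose (k - 2 - j)) * real ((n + 2 * j) choose (2 * j)))
     = (\<Sum>j\<le>K. closed_form_coeff K j * real ((n + 2 * j) choose (2 * j)))" (is "?S = _")
    using K by (intro sum.cong) (auto simp: closed_form_coeff_def of_nat_diff)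
  moreover have "real (K + 1) * 4 ^ K * word_series k 0 $ n =
      2 ^ n * (\<Sum>j\<le>K. closed_form_coeff K j * real ((n + 2 * j) choose (2 * j)))"
    unfolding K by (rule word_series_closed_form)
  ultimately have eq: "real (K + 1) * 4 ^ K * word_series k 0 $ n = 2 ^ n * ?S" by (simp only:)
  have "x = c / b / a * S" if "a * b * x = c * S" "a \<noteq> 0" "b \<noteq> 0" for a b c x S :: real
    using that by (simp add: field_simps)
  from this[OF eq] have "word_series k 0 $ n = 2 ^ n / 4 ^ K / real (K + 1) * ?S"
    by (simp only: of_nat_eq_0_iff power_eq_0_iff) simp
  moreover have "real k - 1 = real (K + 1)" using K by simp
  ultimately show ?thesis
    unfolding pow card_avoiding_words[OF assms(1)] by (simp only:)
qed

end
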